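(* Let $\boldsymbol{\phi}:\mathbb{R}^n\to\mathbb{R}^h$ be a vector of monomials and $\boldsymbol{x}_{\mathrm d}$ a desired state trajectory with frequency variables $\boldsymbol{\omega}\in\mathbb{R}^m$, both of the form described in the context, and let $\Omega=\Omega^{(1)}\cap\Omega^{(2)}\subseteq\mathbb{R}^m$ be the set defined in the context. If $\Omega\neq\emptyset$, then for every $\boldsymbol{\omega}\in\Omega$ the signal $\boldsymbol{\sigma}(t)=\frac{\mathrm d}{\mathrm dt}\boldsymbol{\phi}(\boldsymbol{x}_{\mathrm d}(t))$ is persistently excited (PE).
   Context: **Persistent excitation.** A piecewise continuously differentiable, bounded function $\boldsymbol{\sigma}:\mathbb{R}_{\ge 0}\to\mathbb{R}^h$ is called persistently excited (PE) for all $t\ge t_0$ (initial time $t_0=0$) if there exist constants $\alpha,\alpha_I,T>0$ such that the equivalent conditions $\int_t^{t+T}\boldsymbol{\sigma}\boldsymbol{\sigma}^\top\mathrm d\tau\succeq\alpha\boldsymbol{I}$ and $\frac1T\int_t^{t+T}|\boldsymbol{\sigma}^\top\boldsymbol{\iota}|\,\mathrm d\tau\ge\alpha_I$ hold for all $t\ge t_0$ and every unit vector $\boldsymbol{\iota}\in\mathbb{R}^h$. **Basis functions.** $\phi_{\bar h}(\boldsymbol{x})=\bar f_{\bar h}\prod_{j=1}^n x_j^{f_{j,\bar h}}$ for $\bar h\in\{1,\dots,h\}$, with $\bar f_{\bar h}\in\mathbb{R}\setminus\{0\}$, $f_{j,\bar h}\in\mathbb{N}_0$, and for each $\bar h$ at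 least one $f_{j,\bar h}\neq0$. **Desired states.** $x_{\mathrm d,o}(t)=\sum_{j=1}^m g_{j,o}\sin(\omega_jt)+\sum_{j=1}^m\bar g_{j,o}\cos(\omega_jt)$ for $o\in\{1,\dots,n\}$, with $m\ge1$, $g_{j,o},\bar g_{j,o}\in\mathbb{R}$, where for each $o$ at least one of the $g_{j,o},\bar g_{j,o}$ is nonzero; $\boldsymbol{\omega}=(\omega_1,\dots,\omega_m)^\top\in\mathbb{R}^m$ is the vector of frequency variables. **Representation.** By trigonometric identities one can write, for every $\bar h$ and identically in $t$ and $\boldsymbol{\omega}$, $$\phi_{\bar h}(\boldsymbol{x}_{\mathrm d})=\sum_{l=1}^{L_{\bar h}}a_{l,\bar h}\sin(w_{l,\bar h}t)+\sum_{k=1}^{K_{\bar h}}c_{k,\bar h}\cos(\bar w_{k,\bar h}t)+e_{\bar h},$$ with $a_{l,\bar h},c_{k,\bar h}\in\mathbb{R}\setminus\{0\}$, $e_{\bar h}\in\mathbb{R}$, $w_{l,\bar h}=\sum_{j=1}^m b_{j,l,\bar h}\omega_j$, $\bar w_{k,\bar h}=\sum_{j=1}^m d_{j,k,\bar h}\omega_j$, $b_{j,l,\bar h},d_{j,k,\bar h}\in\mathbb{R}$, $L_{\bar h},K_{\bar h}\in\mathbb{N}_{\ge0}$, $L_{\bar h}+K_{\bar h}\ge1$ (all coefficients independent of $t$ and $\boldsymbol{\omega}$). Such a representation is fixed. **The set $\Omega^{(1)}$.** $\Omega^{(1)}$ is the set of $\boldsymbol{\omega}\in\mathbb{R}^m$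 such that for every $\bar h$: $w_{l_1,\bar h}\neq w_{l_2,\bar h}$ and $w_{l_1,\bar h}\ne-w_{l_2,\bar h}$ for all $1\le l_1<l_2\le L_{\bar h}$, and $\bar w_{k_1,\bar h}\neq\bar w_{k_2,\bar h}$ and $\bar w_{k_1,\bar h}\neq-\bar w_{k_2,\bar h}$ for all $1\le k_1<k_2\le K_{\bar h}$. **The matrices $\boldsymbol{P}$, $\boldsymbol{T}$.** Let $W_{\bar h}=\{w_{1,\bar h},\dots,w_{L_{\bar h},\bar h},\bar w_{1,\bar h},\dots,\bar w_{K_{\bar h},\bar h}\}$, regarded as a list of $L_{\bar h}+K_{\bar h}$ labelled entries. There are $N_P=\prod_{\bar h=1}^h(L_{\bar h}+K_{\bar h})$ ways of selecting one entry from each $W_{\bar h}$, $\bar h=1,\dots,h$; numbering them $n_P=1,\dots,N_P$, let $P_{\bar h,n_P}$ be the entry selected from $W_{\bar h}$ in the $n_P$-th selection, and let $T_{\bar h,n_P}=0$ if this entry is one of the sine frequencies $w_{l,\bar h}$ and $T_{\bar h,n_P}=1$ if it is one of the cosine frequencies $\bar w_{k,\bar h}$. **The set $\Omega^{(2)}$.** $\Omega^{(2)}$ is the set of $\boldsymbol{\omega}\in\mathbb{R}^m$ for which there is at least one $n_P\in\{1,\dots,N_P\}$ such that all of the following hold: (I) $P_{\bar h,n_P}\neq0$ for all $\bar h$; (II) for all $\bar h_1<\bar h_2$ with $T_{\bar h_1,n_P}=T_{\bar h_2,n_P}$: $P_{\bar h_1,n_P}\neq P_{\bar h_2,n_P}$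 and $P_{\bar h_1,n_P}\neq-P_{\bar h_2,n_P}$; (IIIa) for all $\bar h_1\neq\bar h_2$ with $T_{\bar h_1,n_P}=0$ and all $\bar l\in\{1,\dots,L_{\bar h_2}\}$ such that the entry $w_{\bar l,\bar h_2}$ is not the entry selected from $W_{\bar h_2}$ in selection $n_P$: $P_{\bar h_1,n_P}\neq w_{\bar l,\bar h_2}$ and $P_{\bar h_1,n_P}\neq-w_{\bar l,\bar h_2}$; (IIIb) for all $\bar h_1\neq\bar h_2$ with $T_{\bar h_1,n_P}=1$ and all $\bar k\in\{1,\dots,K_{\bar h_2}\}$ such that the entry $\bar w_{\bar k,\bar h_2}$ is not the entry selected from $W_{\bar h_2}$ in selection $n_P$: $P_{\bar h_1,n_P}\neq\bar w_{\bar k,\bar h_2}$ and $P_{\bar h_1,n_P}\neq-\bar w_{\bar k,\bar h_2}$. $\Omega=\Omega^{(1)}\cap\Omega^{(2)}$. *)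

theory Defs
  imports "HOL-Analysis.Analysis"
begin

definition outer :: "real ^ 'h \<Rightarrow> real ^ 'h ^ 'h" where
  "outer v = (\<chi> i j. v $ i * v $ j)"

definition pos_semidef :: "real ^ 'h ^ 'h \<Rightarrow> bool" where
  "pos_semidef A \<longleftrightarrow> transpose A = A \<and> (\<forall>v. 0 \<le> v \<bullet> (A *v v))"

text \<open>
  Signals on the half-line are total functions of which only the values at
  nonnegative times matter. Piecewise continuous differentiability is required on
  every compact initial interval, so that breakpoints need only be locally finite.
  As usual for this library notion, the signal has to be continuous at the breakpoints.
  The two integral conditions are equivalent for such signals; both are required, with
  a common window length \<open>T\<close>.
\<close>

definition persistently_excited :: "(real \<Rightarrow> real ^ 'h) \<Rightarrow> bool" where
  "persistently_excited \<sigma> \<longleftrightarrow>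
     (\<forall>r>0. \<sigma> piecewise_C1_differentiable_on {0..r}) \<and>
     bounded (\<sigma> ` {0..}) \<and>
     (\<exists>\<alpha>>0. \<exists>\<alpha>\<^sub>I>0. \<exists>T>0. \<forall>t\<ge>0.
        pos_semidef (integral {t..t + T} (\<lambda>\<tau>. outer (\<sigma> \<tau>)) - \<alpha> *\<^sub>R mat 1) \<and>
        (\<forall>\<iota>. norm \<iota> = 1 \<longrightarrow>
           \<alpha>\<^sub>I \<le> 1 / T * integral {t..t + T} (\<lambda>\<tau>. \<bar>\<sigma> \<tau> \<bullet> \<iota>\<bar>)))"

definition monomials ::
  "('h \<Rightarrow> real) \<Rightarrow> ('n \<Rightarrow> 'h \<Rightarrow> nat) \<Rightarrow> real ^ 'n \<Rightarrow> real ^ 'h" where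
  "monomials fb f x = (\<chi> h. fb h * (\<Prod>j\<in>UNIV. x $ j ^ f j h))"

definition desired_state ::
  "('m \<Rightarrow> 'n \<Rightarrow> real) \<Rightarrow> ('m \<Rightarrow> 'n \<Rightarrow> real) \<Rightarrow> real ^ 'm \<Rightarrow> real \<Rightarrow> real ^ 'n" where
  "desired_state g gb \<omega> t =
     (\<chi> i. (\<Sum>j\<in>UNIV. g j i * sin (\<omega> $ j * t)) + (\<Sum>j\<in>UNIV. gb j i * cos (\<omega> $ j * t)))"

text \<open>
  Both families of frequencies have this form: the sine frequencies are
  \<open>lin_freq b \<omega> l h\<close> with \<open>l \<in> {1..L h}\<close>, the cosine frequencies
  \<open>lin_freq d \<omega> k h\<close> with \<open>k \<in> {1..K h}\<close>.
\<close>

definition lin_freq :: "('m \<Rightarrow> nat \<Rightarrow> 'h \<Rightarrow> real) \<Rightarrow> real ^ 'm \<Rightarrow> nat \<Rightarrow> 'h \<Rightarrow> real" where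
  "lin_freq b \<omega> l h = (\<Sum>j\<in>UNIV. b j l h * \<omega> $ j)"

definition trig_representation ::
  "('h \<Rightarrow> nat) \<Rightarrow> ('h \<Rightarrow> nat) \<Rightarrow> (nat \<Rightarrow> 'h \<Rightarrow> real) \<Rightarrow> (nat \<Rightarrow> 'h \<Rightarrow> real) \<Rightarrow> ('h \<Rightarrow> real) \<Rightarrow>
   ('m \<Rightarrow> nat \<Rightarrow> 'h \<Rightarrow> real) \<Rightarrow> ('m \<Rightarrow> nat \<Rightarrow> 'h \<Rightarrow> real) \<Rightarrow>
   (real ^ 'm \<Rightarrow> real \<Rightarrow> real ^ 'h) \<Rightarrow> bool" where
  "trig_representation L K a c e b d y \<longleftrightarrow>
     (\<forall>h. L h + K h \<ge> 1) \<and>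
     (\<forall>h. \<forall>l\<in>{1..L h}. a l h \<noteq> 0) \<and>
     (\<forall>h. \<forall>k\<in>{1..K h}. c k h \<noteq> 0) \<and>
     (\<forall>h \<omega> t. y \<omega> t $ h =
        (\<Sum>l = 1..L h. a l h * sin (lin_freq b \<omega> l h * t)) +
        (\<Sum>k = 1..K h. c k h * cos (lin_freq d \<omega> k h * t)) + e h)"

definition Omega1 ::
  "('h \<Rightarrow> nat) \<Rightarrow> ('h \<Rightarrow> nat) \<Rightarrow> ('m \<Rightarrow> nat \<Rightarrow> 'h \<Rightarrow> real) \<Rightarrow> ('m \<Rightarrow> nat \<Rightarrow> 'h \<Rightarrow> real) \<Rightarrow>
   (real ^ 'm) set" where
  "Omega1 L K b d = {\<omega>. \<forall>h.
     (\<forall>l1 l2. 1 \<le> l1 \<and> l1 < l2 \<and> l2 \<le> L h \<longrightarrow>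
        lin_freq b \<omega> l1 h \<noteq> lin_freq b \<omega> l2 h \<and>
        lin_freq b \<omega> l1 h \<noteq> - lin_freq b \<omega> l2 h) \<and>
     (\<forall>k1 k2. 1 \<le> k1 \<and> k1 < k2 \<and> k2 \<le> K h \<longrightarrow>
        lin_freq d \<omega> k1 h \<noteq> lin_freq d \<omega> k2 h \<and>
        lin_freq d \<omega> k1 h \<noteq> - lin_freq d \<omega> k2 h)}"

text \<open>
  The entries of the lists \<open>W\<^sub>h\<close> are represented by their labels, so that entries of
  equal value stay distinct. A selection \<open>s\<close> of one label per component takes the place of
  the column index of the matrices \<open>P\<close> and \<open>T\<close>; their entries in row \<open>h\<close> of that column are
  \<open>P_entry b d \<omega> s h\<close> and \<open>T_entry s h\<close>.
\<close>

datatype label = Sine nat | Cosine nat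

definition labels :: "('h \<Rightarrow> nat) \<Rightarrow> ('h \<Rightarrow> nat) \<Rightarrow> 'h \<Rightarrow> label set" where
  "labels L K h = Sine ` {1..L h} \<union> Cosine ` {1..K h}"

definition selections :: "('h \<Rightarrow> nat) \<Rightarrow> ('h \<Rightarrow> nat) \<Rightarrow> ('h \<Rightarrow> label) set" where
  "selections L K = {s. \<forall>h. s h \<in> labels L K h}"

definition P_entry ::
  "('m \<Rightarrow> nat \<Rightarrow> 'h \<Rightarrow> real) \<Rightarrow> ('m \<Rightarrow> nat \<Rightarrow> 'h \<Rightarrow> real) \<Rightarrow> real ^ 'm \<Rightarrow> ('h \<Rightarrow> label) \<Rightarrow> 'h \<Rightarrow> real"
  where
  "P_entry b d \<omega> s h =
     (case s h of Sine l \<Rightarrow> lin_freq b \<omega> l h | Cosine k \<Rightarrow> lin_freq d \<omega> k h)"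

definition T_entry :: "('h \<Rightarrow> label) \<Rightarrow> 'h \<Rightarrow> nat" where
  "T_entry s h = (case s h of Sine l \<Rightarrow> 0 | Cosine k \<Rightarrow> 1)"

text \<open>
  The index type of the components carries no order. The second clause is symmetric in
  \<open>h1\<close> and \<open>h2\<close>, so ranging over \<open>h1 \<noteq> h2\<close> amounts to ranging over \<open>h1 < h2\<close>.
\<close>

definition Omega2 ::
  "('h \<Rightarrow> nat) \<Rightarrow> ('h \<Rightarrow> nat) \<Rightarrow> ('m \<Rightarrow> nat \<Rightarrow> 'h \<Rightarrow> real) \<Rightarrow> ('m \<Rightarrow> nat \<Rightarrow> 'h \<Rightarrow> real) \<Rightarrow>
   (real ^ 'm) set" where
  "Omega2 L K b d = {\<omega>. \<exists>s\<in>selections L K.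
     (\<forall>h. P_entry b d \<omega> s h \<noteq> 0) \<and>
     (\<forall>h1 h2. h1 \<noteq> h2 \<and> T_entry s h1 = T_entry s h2 \<longrightarrow>
        P_entry b d \<omega> s h1 \<noteq> P_entry b d \<omega> s h2 \<and>
        P_entry b d \<omega> s h1 \<noteq> - P_entry b d \<omega> s h2) \<and>
     (\<forall>h1 h2. h1 \<noteq> h2 \<and> T_entry s h1 = 0 \<longrightarrow>
        (\<forall>l\<in>{1..L h2}. s h2 \<noteq> Sine l \<longrightarrow>
           P_entry b d \<omega> s h1 \<noteq> lin_freq b \<omega> l h2 \<and>
           P_entry b d \<omega> s h1 \<noteq> - lin_freq b \<omega> l h2)) \<and>
     (\<forall>h1 h2. h1 \<noteq> h2 \<and> T_entry s h1 = 1 \<longrightarrow>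
        (\<forall>k\<in>{1..K h2}. s h2 \<noteq> Cosine k \<longrightarrow>
           P_entry b d \<omega> s h1 \<noteq> lin_freq d \<omega> k h2 \<and>
           P_entry b d \<omega> s h1 \<noteq> - lin_freq d \<omega> k h2))}"

definition Omega ::
  "('h \<Rightarrow> nat) \<Rightarrow> ('h \<Rightarrow> nat) \<Rightarrow> ('m \<Rightarrow> nat \<Rightarrow> 'h \<Rightarrow> real) \<Rightarrow> ('m \<Rightarrow> nat \<Rightarrow> 'h \<Rightarrow> real) \<Rightarrow>
   (real ^ 'm) set" where
  "Omega L K b d = Omega1 L K b d \<inter> Omega2 L K b d"

end

theory Submission
  imports Defs
begin

text \<open>
  The derivative \<open>\<sigma>\<close> is a real trigonometric polynomial in each component. Let \<open>P\<close> be the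
  frequency selected in component \<open>h0\<close>, and let \<open>q\<close> be \<open>cos (P * t)\<close> or \<open>sin (P * t)\<close>, whichever the
  corresponding term of \<open>\<sigma>\<close> contains. The conditions defining \<open>\<Omega>\<close> say that the mean of \<open>\<sigma> $ h * q\<close>
  vanishes for \<open>h \<noteq> h0\<close> and does not vanish for \<open>h = h0\<close>, with an error of the integrals that
  stays bounded on all windows. Hence \<open>\<integral> \<bar>\<sigma> \<bullet> v\<bar> \<ge> \<bar>\<integral> (\<sigma> \<bullet> v) * q\<bar> \<ge> \<kappa> * \<bar>v $ h0\<bar> * T - C\<close> on every window
  of length \<open>T\<close>; for a unit vector \<open>v\<close> some entry satisfies \<open>\<bar>v $ h0\<bar> \<ge> 1 / CARD('h)\<close>, and a
  sufficiently long window gives the excitation.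
\<close>

section \<open>Functions with a bounded primitive\<close>

text \<open>This encodes mean value zero in a quantitative form: if the primitive is bounded by
  \<open>C\<close>, every window integral is at most \<open>2 * C\<close> in absolute value,
  whatever its position and length. The form is stable under linear combinations.\<close>

definition bounded_primitive :: "(real \<Rightarrow> real) \<Rightarrow> bool" where
  "bounded_primitive u \<longleftrightarrow>
     (\<exists>U C. (\<forall>t. (U has_real_derivative u t) (at t)) \<and> (\<forall>t. \<bar>U t\<bar> \<le> C))"

lemma bounded_primitive_zero: "bounded_primitive (\<lambda>t. 0)"
  unfolding bounded_primitive_def
  by (rule exI[of _ "\<lambda>t. 0"], rule exI[of _ 0]) simp

lemma bounded_primitive_add:
  assumes "bounded_primitive u" "bounded_primitive v"
  shows "bounded_primitive (\<lambda>t. u t + v t)"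
proof -
  obtain U C V D where "\<forall>t. (U has_real_derivative u t) (at t)" "\<forall>t. \<bar>U t\<bar> \<le> C"
    "\<forall>t. (V has_real_derivative v t) (at t)" "\<forall>t. \<bar>V t\<bar> \<le> D"
    using assms unfolding bounded_primitive_def by blast
  then have "\<forall>t. ((\<lambda>t. U t + V t) has_real_derivative u t + v t) (at t)"
    and "\<forall>t. \<bar>U t + V t\<bar> \<le> C + D"
    by (auto intro!: DERIV_add order_trans[OF abs_triangle_ineq] add_mono)
  then show ?thesis unfolding bounded_primitive_def by blast
qed

lemma bounded_primitive_cmult:
  assumes "bounded_primitive u"
  shows "bounded_primitive (\<lambda>t. k * u t)"
proof -
  obtain U C where "\<forall>t. (U has_real_derivative u t) (at t)" "\<forall>t. \<bar>U t\<bar> \<le> C"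
    using assms unfolding bounded_primitive_def by blast
  then have "\<forall>t. ((\<lambda>t. k * U t) has_real_derivative k * u t) (at t)"
    and "\<forall>t. \<bar>k * U t\<bar> \<le> \<bar>k\<bar> * C"
    by (auto intro: DERIV_cmult simp: abs_mult mult_left_mono)
  then show ?thesis unfolding bounded_primitive_def by blast
qed

lemma bounded_primitive_diff:
  assumes "bounded_primitive u" "bounded_primitive v"
  shows "bounded_primitive (\<lambda>t. u t - v t)"
  using bounded_primitive_add[OF assms(1) bounded_primitive_cmult[OF assms(2), of "-1"]] by simp

lemma bounded_primitive_sum:
  assumes "\<And>i. i \<in> I \<Longrightarrow> bounded_primitive (u i)"
  shows "bounded_primitive (\<lambda>t. \<Sum>i\<in>I. u i t)"
  using assms
  by (induction I rule: infinite_finite_induct)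
    (auto intro: bounded_primitive_zero bounded_primitive_add)

lemma bounded_primitive_cos:
  assumes "w \<noteq> 0"
  shows "bounded_primitive (\<lambda>t. cos (w * t))"
proof -
  have "\<forall>t. ((\<lambda>t. sin (w * t) / w) has_real_derivative cos (w * t)) (at t)"
    using assms by (auto intro!: derivative_eq_intros)
  moreover have "\<forall>t. \<bar>sin (w * t) / w\<bar> \<le> 1 / \<bar>w\<bar>"
    by (simp add: divide_right_mono)
  ultimately show ?thesis unfolding bounded_primitive_def by blast
qed

text \<open>At frequency zero the sine vanishes, whereas the cosine is the constant 1 with an
  unbounded primitive. Hence a frequency condition appears for the cosine only.\<close>

lemma bounded_primitive_sin: "bounded_primitive (\<lambda>t. sin (w * t))"
proof (cases "w = 0")
  case True
  then show ?thesis by (simp add: bounded_primitive_zero)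
next
  case False
  then have "\<forall>t. ((\<lambda>t. - cos (w * t) / w) has_real_derivative sin (w * t)) (at t)"
    by (auto intro!: derivative_eq_intros)
  moreover have "\<forall>t. \<bar>- cos (w * t) / w\<bar> \<le> 1 / \<bar>w\<bar>"
    by (simp add: divide_right_mono)
  ultimately show ?thesis unfolding bounded_primitive_def by blast
qed

section \<open>Products of two sinusoids\<close>

text \<open>By the product-to-sum formula the product is a combination of cosines of frequencies
  \<open>w - P\<close> and \<open>w + P\<close>; the assumptions say that neither is zero.\<close>

lemma bounded_primitive_cos_cos:
  assumes "P \<noteq> w" "P \<noteq> - w"
  shows "bounded_primitive (\<lambda>t. cos (w * t) * cos (P * t))"
proof -
  have "bounded_primitive (\<lambda>t. 1/2 * cos ((w - P) * t) + 1/2 * cos ((w + P) * t))"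
    using assms by (intro bounded_primitive_add bounded_primitive_cmult bounded_primitive_cos) auto
  then show ?thesis
    by (rule back_subst) (auto simp: fun_eq_iff cos_add cos_diff algebra_simps)
qed

lemma bounded_primitive_sin_sin:
  assumes "P \<noteq> w" "P \<noteq> - w"
  shows "bounded_primitive (\<lambda>t. sin (w * t) * sin (P * t))"
proof -
  have "bounded_primitive (\<lambda>t. 1/2 * cos ((w - P) * t) - 1/2 * cos ((w + P) * t))"
    using assms by (intro bounded_primitive_diff bounded_primitive_cmult bounded_primitive_cos) auto
  then show ?thesis
    by (rule back_subst) (auto simp: fun_eq_iff cos_add cos_diff algebra_simps)
qed

text \<open>The product-to-sum formula yields sines only, so resonance is harmless here. This is why
  the conditions defining \<open>Omega\<close> need to compare only frequencies of equal
  type.\<close>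

lemma bounded_primitive_sin_cos: "bounded_primitive (\<lambda>t. sin (w * t) * cos (P * t))"
proof -
  have "bounded_primitive (\<lambda>t. 1/2 * sin ((w - P) * t) + 1/2 * sin ((w + P) * t))"
    by (intro bounded_primitive_add bounded_primitive_cmult bounded_primitive_sin)
  then show ?thesis
    by (rule back_subst) (auto simp: fun_eq_iff sin_add sin_diff algebra_simps)
qed

text \<open>The double-angle formula leaves a cosine of frequency \<open>2 * P\<close> once the mean
  1/2 is subtracted. This mean is the source of the nonzero correlation.\<close>

lemma bounded_primitive_cos_squared:
  assumes "P \<noteq> 0"
  shows "bounded_primitive (\<lambda>t. cos (P * t) * cos (P * t) - 1/2)"
proof -
  have "bounded_primitive (\<lambda>t. 1/2 * cos ((2 * P) * t))"
    using assms by (intro bounded_primitive_cmult bounded_primitive_cos) auto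
  moreover have "1/2 * cos ((2 * P) * t) = cos (P * t) * cos (P * t) - 1/2" for t
    using cos_double_cos[of "P * t"] by (simp add: power2_eq_square mult.assoc diff_divide_distrib)
  ultimately show ?thesis by (simp only:)
qed

lemma bounded_primitive_sin_squared:
  assumes "P \<noteq> 0"
  shows "bounded_primitive (\<lambda>t. sin (P * t) * sin (P * t) - 1/2)"
proof -
  have "bounded_primitive (\<lambda>t. (-1/2) * cos ((2 * P) * t))"
    using assms by (intro bounded_primitive_cmult bounded_primitive_cos) auto
  moreover have "(-1/2) * cos ((2 * P) * t) = sin (P * t) * sin (P * t) - 1/2" for t
    using cos_double_sin[of "P * t"] by (simp add: power2_eq_square mult.assoc diff_divide_distrib)
  ultimately show ?thesis by (simp only:)
qed

section \<open>Correlation of a trigonometric polynomial with a sinusoid\<close>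

text \<open>The shape of the sum is that of a component of \<sigma>. Testing against a cosine
  requires nonresonance with the cosine terms alone, as mixed products always have a bounded
  primitive.\<close>

lemma bounded_primitive_trig_cos:
  assumes "finite I" "finite J" and "\<And>i. i \<in> I \<Longrightarrow> P \<noteq> w i \<and> P \<noteq> - w i"
  shows "bounded_primitive
    (\<lambda>t. ((\<Sum>i\<in>I. A i * cos (w i * t)) - (\<Sum>j\<in>J. B j * sin (z j * t))) * cos (P * t))"
proof -
  have "bounded_primitive (\<lambda>t. (\<Sum>i\<in>I. A i * (cos (w i * t) * cos (P * t)))
      - (\<Sum>j\<in>J. B j * (sin (z j * t) * cos (P * t))))"
    using assms
    by (intro bounded_primitive_diff bounded_primitive_sum bounded_primitive_cmult
        bounded_primitive_cos_cos bounded_primitive_sin_cos) auto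
  then show ?thesis
    by (simp add: left_diff_distrib sum_distrib_right mult.assoc)
qed

lemma bounded_primitive_trig_sin:
  assumes "finite I" "finite J" and "\<And>j. j \<in> J \<Longrightarrow> P \<noteq> z j \<and> P \<noteq> - z j"
  shows "bounded_primitive
    (\<lambda>t. ((\<Sum>i\<in>I. A i * cos (w i * t)) - (\<Sum>j\<in>J. B j * sin (z j * t))) * sin (P * t))"
proof -
  have cos_sin: "bounded_primitive (\<lambda>t. cos (u * t) * sin (P * t))" for u
    using bounded_primitive_sin_cos[of P u] by (simp add: mult.commute)
  have "bounded_primitive (\<lambda>t. (\<Sum>i\<in>I. A i * (cos (w i * t) * sin (P * t)))
      - (\<Sum>j\<in>J. B j * (sin (z j * t) * sin (P * t))))"
    using assms
    by (intro bounded_primitive_diff bounded_primitive_sum bounded_primitive_cmult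
        bounded_primitive_sin_sin cos_sin) auto
  then show ?thesis
    by (simp add: left_diff_distrib sum_distrib_right mult.assoc)
qed

text \<open>The term \<open>l\<close> is split off. The rest, over \<open>I - {l}\<close>, is
  nonresonant, and the split term contributes \<open>A l\<close> times a squared cosine, hence the
  mean \<open>A l / 2\<close>.\<close>

lemma bounded_primitive_trig_cos_selected:
  assumes "finite I" "finite J" "l \<in> I" "w l \<noteq> 0"
    and "\<And>i. i \<in> I \<Longrightarrow> i \<noteq> l \<Longrightarrow> w l \<noteq> w i \<and> w l \<noteq> - w i"
  shows "bounded_primitive
    (\<lambda>t. ((\<Sum>i\<in>I. A i * cos (w i * t)) - (\<Sum>j\<in>J. B j * sin (z j * t))) * cos (w l * t) - A l / 2)"
proof -
  have "bounded_primitive (\<lambda>t. ((\<Sum>i\<in>I - {l}. A i * cos (w i * t)) - (\<Sum>j\<in>J. B j * sin (z j * t)))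
      * cos (w l * t) + A l * (cos (w l * t) * cos (w l * t) - 1/2))"
    using assms
    by (intro bounded_primitive_add bounded_primitive_trig_cos bounded_primitive_cmult
        bounded_primitive_cos_squared) auto
  then show ?thesis
    using assms by (simp add: sum.remove[of I l] algebra_simps)
qed

lemma bounded_primitive_trig_sin_selected:
  assumes "finite I" "finite J" "k \<in> J" "z k \<noteq> 0"
    and "\<And>j. j \<in> J \<Longrightarrow> j \<noteq> k \<Longrightarrow> z k \<noteq> z j \<and> z k \<noteq> - z j"
  shows "bounded_primitive
    (\<lambda>t. ((\<Sum>i\<in>I. A i * cos (w i * t)) - (\<Sum>j\<in>J. B j * sin (z j * t))) * sin (z k * t) - (- B k / 2))"
proof -
  have "bounded_primitive (\<lambda>t. ((\<Sum>i\<in>I. A i * cos (w i * t)) - (\<Sum>j\<in>J - {k}. B j * sin (z j * t)))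
      * sin (z k * t) - B k * (sin (z k * t) * sin (z k * t) - 1/2))"
    using assms
    by (intro bounded_primitive_diff bounded_primitive_trig_sin bounded_primitive_cmult
        bounded_primitive_sin_squared) auto
  then show ?thesis
    using assms by (simp add: sum.remove[of J k] algebra_simps)
qed

section \<open>Auxiliary facts on vectors and matrices\<close>

lemma has_vector_derivative_vec_componentwise:
  fixes F :: "real \<Rightarrow> real ^ 'h::finite"
  assumes "\<And>h. ((\<lambda>t. F t $ h) has_real_derivative D $ h) (at t)"
  shows "(F has_vector_derivative D) (at t)"
proof -
  have "((\<lambda>t. F t $ h) has_derivative (\<lambda>x. x * D $ h)) (at t)" for h
    using assms[of h] by (simp add: has_field_derivative_def mult.commute[of "D $ h"] mult_commute_abs)
  then show ?thesis
    unfolding has_vector_derivative_def has_derivative_componentwise_within[of F]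
    by (auto simp: Basis_vec_def inner_axis)
qed

text \<open>Both the quadratic form at \<open>v\<close> and the transpose are bounded linear in the
  matrix, so they commute with the integral; pointwise, \<open>outer x\<close> has the quadratic
  form \<open>(x \<bullet> v)\<^sup>2\<close> and is symmetric.\<close>

lemma integral_outer_quadratic_form:
  fixes \<sigma> :: "real \<Rightarrow> real ^ 'h::finite"
  assumes "continuous_on {p..q} \<sigma>"
  shows "v \<bullet> (integral {p..q} (\<lambda>\<tau>. outer (\<sigma> \<tau>)) *v v) = integral {p..q} (\<lambda>\<tau>. (\<sigma> \<tau> \<bullet> v)\<^sup>2)"
    and "transpose (integral {p..q} (\<lambda>\<tau>. outer (\<sigma> \<tau>))) = integral {p..q} (\<lambda>\<tau>. outer (\<sigma> \<tau>))"
proof -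
  have "continuous_on {p..q} (\<lambda>\<tau>. outer (\<sigma> \<tau>))"
    unfolding outer_def
    by (intro continuous_on_vec_lambda continuous_intros assms)
  then have int: "(\<lambda>\<tau>. outer (\<sigma> \<tau>)) integrable_on {p..q}"
    by (rule integrable_continuous_real)
  have "linear (\<lambda>A :: real ^ 'h ^ 'h. v \<bullet> (A *v v))"
    by (rule linearI)
      (simp_all add: matrix_vector_mult_add_rdistrib inner_add_right scaleR_matrix_vector_assoc[symmetric])
  then have "bounded_linear (\<lambda>A :: real ^ 'h ^ 'h. v \<bullet> (A *v v))"
    by (simp add: linear_conv_bounded_linear)
  from integral_linear[OF int this]
  have "v \<bullet> (integral {p..q} (\<lambda>\<tau>. outer (\<sigma> \<tau>)) *v v) = integral {p..q} (\<lambda>\<tau>. v \<bullet> (outer (\<sigma> \<tau>) *v v))"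
    by (simp add: o_def)
  moreover have "v \<bullet> (outer x *v v) = (x \<bullet> v)\<^sup>2" for x
    by (simp add: outer_def inner_vec_def matrix_vector_mult_def power2_eq_square sum_product
        sum_distrib_left mult_ac)
  ultimately show "v \<bullet> (integral {p..q} (\<lambda>\<tau>. outer (\<sigma> \<tau>)) *v v) = integral {p..q} (\<lambda>\<tau>. (\<sigma> \<tau> \<bullet> v)\<^sup>2)"
    by simp
  have "linear (transpose :: real ^ 'h ^ 'h \<Rightarrow> _)"
    by (rule linearI) (simp_all add: transpose_def vec_eq_iff)
  then have "bounded_linear (transpose :: real ^ 'h ^ 'h \<Rightarrow> _)"
    by (simp add: linear_conv_bounded_linear)
  from integral_linear[OF int this]
  have "transpose (integral {p..q} (\<lambda>\<tau>. outer (\<sigma> \<tau>))) = integral {p..q} (\<lambda>\<tau>. transpose (outer (\<sigma> \<tau>)))"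
    by (simp add: o_def)
  moreover have "transpose (outer x) = outer x" for x :: "real ^ 'h"
    by (simp add: outer_def transpose_def vec_eq_iff)
  ultimately show "transpose (integral {p..q} (\<lambda>\<tau>. outer (\<sigma> \<tau>))) = integral {p..q} (\<lambda>\<tau>. outer (\<sigma> \<tau>))"
    by simp
qed

text \<open>Otherwise the sum of the absolute entries would be less than 1, although it bounds the
  Euclidean norm from above.\<close>

lemma exists_large_component:
  fixes v :: "real ^ 'h::finite"
  assumes "norm v = 1"
  obtains h where "\<bar>v $ h\<bar> \<ge> 1 / real CARD('h)"
proof (rule ccontr)
  assume "\<not> thesis"
  then have "\<And>h. \<bar>v $ h\<bar> < 1 / real CARD('h)"
    using that by (meson not_le_imp_less)
  then have "(\<Sum>h\<in>UNIV. \<bar>v $ h\<bar>) < (\<Sum>h\<in>(UNIV :: 'h set). 1 / real CARD('h))"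
    by (intro sum_strict_mono) auto
  with norm_le_l1_cart[of v] assms show False by simp
qed

section \<open>From correlations to persistent excitation\<close>

text \<open>Since \<open>\<bar>q t\<bar> \<le> 1\<close>, testing against \<open>q\<close> can only
  decrease the integral of \<open>\<bar>\<sigma> \<tau> \<bullet> v\<bar>\<close>, and the tested
  integral grows linearly in \<open>T\<close>. What matters is that \<open>C\<close> is chosen
  before \<open>v\<close>, \<open>t\<close> and \<open>T\<close>.\<close>

lemma integral_abs_lower_bound:
  fixes \<sigma> :: "real \<Rightarrow> real ^ 'h::finite"
  assumes cont: "continuous_on UNIV \<sigma>"
    and q: "continuous_on UNIV q" "\<And>t. \<bar>q t\<bar> \<le> 1"
    and prim: "\<And>h. bounded_primitive (\<lambda>t. \<sigma> t $ h * q t - (if h = h0 then \<kappa> else 0))"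
  shows "\<exists>C. \<forall>v t T. norm v = 1 \<longrightarrow> 0 \<le> T \<longrightarrow>
    \<bar>v $ h0\<bar> * \<bar>\<kappa>\<bar> * T - C \<le> integral {t..t + T} (\<lambda>\<tau>. \<bar>\<sigma> \<tau> \<bullet> v\<bar>)"
proof -
  obtain U C where U:
    "\<And>h t. (U h has_real_derivative \<sigma> t $ h * q t - (if h = h0 then \<kappa> else 0)) (at t)"
    and C: "\<And>h t. \<bar>U h t\<bar> \<le> C h"
    using prim unfolding bounded_primitive_def by metis
  have "\<bar>v $ h0\<bar> * \<bar>\<kappa>\<bar> * T - 2 * sum C UNIV \<le> integral {t..t + T} (\<lambda>\<tau>. \<bar>\<sigma> \<tau> \<bullet> v\<bar>)"
    if v: "norm v = 1" and T: "0 \<le> T" for v t T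
  proof -
    \<comment> \<open>The bounded part of a primitive of
      \<open>(\<sigma> x \<bullet> v) * q x\<close>; the unbounded part is the linear term
      \<open>v $ h0 * \<kappa> * t\<close>. Entries of a unit vector are at most 1 in absolute
      value, so the bound on \<open>V\<close> does not depend on \<open>v\<close>.\<close>
    define V where "V t = (\<Sum>h\<in>UNIV. v $ h * U h t)" for t
    have "\<bar>V t\<bar> \<le> (\<Sum>h\<in>UNIV. \<bar>v $ h * U h t\<bar>)" for t
      unfolding V_def by (rule sum_abs)
    also have "(\<Sum>h\<in>UNIV. \<bar>v $ h * U h t\<bar>) \<le> sum C UNIV" for t
    proof (rule sum_mono)
      fix h
      have "\<bar>v $ h\<bar> \<le> 1" using component_le_norm_cart[of v h] v by simp
      then have "\<bar>v $ h\<bar> * \<bar>U h t\<bar> \<le> 1 * C h" using C by (intro mult_mono) auto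
      then show "\<bar>v $ h * U h t\<bar> \<le> C h" by (simp add: abs_mult)
    qed
    finally have V_bound: "\<bar>V t\<bar> \<le> sum C UNIV" for t .
    have "((\<lambda>t. V t + v $ h0 * \<kappa> * t) has_real_derivative (\<sigma> x \<bullet> v) * q x) (at x)" for x
    proof -
      have "((\<lambda>t. V t + v $ h0 * \<kappa> * t) has_real_derivative
          (\<Sum>h\<in>UNIV. v $ h * (\<sigma> x $ h * q x - (if h = h0 then \<kappa> else 0))) + v $ h0 * \<kappa>) (at x)"
        unfolding V_def by (auto intro!: derivative_eq_intros U simp: mult.commute)
      moreover have "(\<Sum>h\<in>UNIV. v $ h * (\<sigma> x $ h * q x - (if h = h0 then \<kappa> else 0)))
          = (\<Sum>h\<in>UNIV. v $ h * (\<sigma> x $ h * q x)) - (\<Sum>h\<in>UNIV. if h = h0 then v $ h * \<kappa> else 0)"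
        unfolding sum_subtractf[symmetric] by (rule sum.cong) (auto simp: right_diff_distrib)
      moreover have "(\<Sum>h\<in>UNIV. v $ h * (\<sigma> x $ h * q x)) = (\<sigma> x \<bullet> v) * q x"
        by (simp add: inner_vec_def sum_distrib_left mult_ac)
      ultimately show ?thesis by simp
    qed
    then have "((\<lambda>x. (\<sigma> x \<bullet> v) * q x) has_integral
        (V (t + T) + v $ h0 * \<kappa> * (t + T)) - (V t + v $ h0 * \<kappa> * t)) {t..t + T}"
      using T by (intro fundamental_theorem_of_calculus)
        (auto simp: has_real_derivative_iff_has_vector_derivative[symmetric]
          intro: has_field_derivative_at_within)
    then have eq: "integral {t..t + T} (\<lambda>x. (\<sigma> x \<bullet> v) * q x) = V (t + T) - V t + v $ h0 * \<kappa> * T"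
      by (simp add: integral_unique algebra_simps)
    have cont': "continuous_on {t..t + T} \<sigma>" "continuous_on {t..t + T} q"
      using cont q(1) continuous_on_subset by blast+
    have "norm (integral {t..t + T} (\<lambda>x. (\<sigma> x \<bullet> v) * q x)) \<le> integral {t..t + T} (\<lambda>\<tau>. \<bar>\<sigma> \<tau> \<bullet> v\<bar>)"
    proof (rule integral_norm_bound_integral)
      show "norm ((\<sigma> x \<bullet> v) * q x) \<le> \<bar>\<sigma> x \<bullet> v\<bar>" for x
        using mult_left_mono[OF q(2)[of x], of "\<bar>\<sigma> x \<bullet> v\<bar>"] by (simp add: abs_mult)
    qed (intro integrable_continuous_real continuous_intros cont')+
    moreover have "\<bar>v $ h0\<bar> * \<bar>\<kappa>\<bar> * T = \<bar>v $ h0 * \<kappa> * T\<bar>"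
      using T by (simp add: abs_mult)
    ultimately show ?thesis
      using eq V_bound[of "t + T"] V_bound[of t] by auto
  qed
  then show ?thesis by blast
qed

text \<open>Each test function controls one entry of the direction. As there are finitely many
  entries, a single window length serves all directions; the matrix bound is then deduced from the
  bound on the integral of the absolute value.\<close>

lemma persistent_excitation_by_correlation:
  fixes \<sigma> :: "real \<Rightarrow> real ^ 'h::finite"
  assumes cont: "continuous_on UNIV \<sigma>"
    and corr: "\<And>h0. \<exists>q \<kappa>. continuous_on UNIV q \<and> (\<forall>t. \<bar>q t\<bar> \<le> 1) \<and> \<kappa> \<noteq> 0 \<and>
      (\<forall>h. bounded_primitive (\<lambda>t. \<sigma> t $ h * q t - (if h = h0 then \<kappa> else 0)))"
  shows "\<exists>\<alpha>>0. \<exists>\<alpha>\<^sub>I>0. \<exists>T>0. \<forall>t\<ge>0.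
    pos_semidef (integral {t..t + T} (\<lambda>\<tau>. outer (\<sigma> \<tau>)) - \<alpha> *\<^sub>R mat 1) \<and>
    (\<forall>\<iota>. norm \<iota> = 1 \<longrightarrow> \<alpha>\<^sub>I \<le> 1 / T * integral {t..t + T} (\<lambda>\<tau>. \<bar>\<sigma> \<tau> \<bullet> \<iota>\<bar>))"
proof -
  have "\<forall>h0. \<exists>\<kappa> C. \<kappa> \<noteq> 0 \<and> (\<forall>v t T. norm v = 1 \<longrightarrow> 0 \<le> T \<longrightarrow>
      \<bar>v $ h0\<bar> * \<bar>\<kappa>\<bar> * T - C \<le> integral {t..t + T} (\<lambda>\<tau>. \<bar>\<sigma> \<tau> \<bullet> v\<bar>))"
    using corr integral_abs_lower_bound[OF cont] by meson
  then obtain \<kappa> C where \<kappa>: "\<And>h0. \<kappa> h0 \<noteq> 0"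
    and lower: "\<And>h0 v t T. norm v = 1 \<Longrightarrow> 0 \<le> T \<Longrightarrow>
      \<bar>v $ h0\<bar> * \<bar>\<kappa> h0\<bar> * T - C h0 \<le> integral {t..t + T} (\<lambda>\<tau>. \<bar>\<sigma> \<tau> \<bullet> v\<bar>)"
    by metis
  \<comment> \<open>For a unit vector, \<open>\<mu>\<close> bounds the slope
    \<open>\<bar>v $ h\<bar> * \<bar>\<kappa> h\<bar>\<close> from below at its large entry
    \<open>h\<close>, and \<open>\<gamma>\<close> dominates every \<open>C h\<close>. The choice of
    \<open>T\<close> lets the error use up at most half of the growth \<open>\<mu> * T\<close>; the
    summand 1 keeps \<open>T\<close> positive if \<open>\<gamma>\<close> is zero.\<close>
  define \<mu> where "\<mu> = Min (range (\<lambda>h. \<bar>\<kappa> h\<bar>)) / real CARD('h)"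
  define \<gamma> where "\<gamma> = (\<Sum>h\<in>UNIV. \<bar>C h\<bar>)"
  define T where "T = 2 * \<gamma> / \<mu> + 1"
  have "0 < Min (range (\<lambda>h. \<bar>\<kappa> h\<bar>))" using \<kappa> by (subst Min_gr_iff) auto
  then have \<mu>: "0 < \<mu>" by (simp add: \<mu>_def)
  have "0 \<le> \<gamma>" by (simp add: \<gamma>_def sum_nonneg)
  with \<mu> have T: "0 < T" by (simp add: T_def add_nonneg_pos)
  have \<gamma>_le: "\<gamma> \<le> \<mu> / 2 * T" using \<mu> by (simp add: T_def field_simps)
  have abs_int: "\<mu> / 2 * T \<le> integral {t..t + T} (\<lambda>\<tau>. \<bar>\<sigma> \<tau> \<bullet> v\<bar>)" if v: "norm v = 1" for v t
  proof -
    obtain h where h: "1 / real CARD('h) \<le> \<bar>v $ h\<bar>"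
      using exists_large_component[OF v] .
    have "Min (range (\<lambda>h. \<bar>\<kappa> h\<bar>)) \<le> \<bar>\<kappa> h\<bar>" by simp
    with h have "1 / real CARD('h) * Min (range (\<lambda>h. \<bar>\<kappa> h\<bar>)) \<le> \<bar>v $ h\<bar> * \<bar>\<kappa> h\<bar>"
      using \<open>0 < Min (range (\<lambda>h. \<bar>\<kappa> h\<bar>))\<close> by (intro mult_mono) auto
    then have "\<mu> * T \<le> \<bar>v $ h\<bar> * \<bar>\<kappa> h\<bar> * T"
      using T by (intro mult_right_mono) (auto simp: \<mu>_def)
    moreover have "\<bar>C h\<bar> \<le> \<gamma>"
      unfolding \<gamma>_def by (rule member_le_sum) auto
    ultimately show ?thesis
      using lower[OF v, of T h t] T \<gamma>_le by linarith
  qed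
  have sq_int: "(\<mu> / 2)\<^sup>2 * T \<le> integral {t..t + T} (\<lambda>\<tau>. (\<sigma> \<tau> \<bullet> v)\<^sup>2)" if v: "norm v = 1" for v t
  proof -
    have cont': "continuous_on {t..t + T} \<sigma>"
      using cont continuous_on_subset by blast
    \<comment> \<open>In place of the Cauchy-Schwarz inequality, the square of
      \<open>\<bar>\<sigma> \<tau> \<bullet> v\<bar> - \<mu> / 2\<close> being nonnegative is
      integrated. With \<open>abs_int\<close> this leaves
      \<open>\<mu> * (\<mu> / 2 * T) - (\<mu> / 2)\<^sup>2 * T\<close>, which equals
      \<open>(\<mu> / 2)\<^sup>2 * T\<close>.\<close>
    have "integral {t..t + T} (\<lambda>\<tau>. \<mu> * \<bar>\<sigma> \<tau> \<bullet> v\<bar> - (\<mu> / 2)\<^sup>2)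
        \<le> integral {t..t + T} (\<lambda>\<tau>. (\<sigma> \<tau> \<bullet> v)\<^sup>2)"
    proof (rule integral_le)
      show "\<mu> * \<bar>\<sigma> x \<bullet> v\<bar> - (\<mu> / 2)\<^sup>2 \<le> (\<sigma> x \<bullet> v)\<^sup>2" for x
        using zero_le_power2[of "\<bar>\<sigma> x \<bullet> v\<bar> - \<mu> / 2"] by (simp add: power2_diff mult_ac)
    qed (intro integrable_continuous_real continuous_intros cont')+
    also have "integral {t..t + T} (\<lambda>\<tau>. \<mu> * \<bar>\<sigma> \<tau> \<bullet> v\<bar> - (\<mu> / 2)\<^sup>2)
        = integral {t..t + T} (\<lambda>\<tau>. \<mu> * \<bar>\<sigma> \<tau> \<bullet> v\<bar>) - integral {t..t + T} (\<lambda>\<tau>. (\<mu> / 2)\<^sup>2)"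
      by (rule Henstock_Kurzweil_Integration.integral_diff)
        (intro integrable_continuous_real continuous_intros cont')+
    also have "\<dots> = \<mu> * integral {t..t + T} (\<lambda>\<tau>. \<bar>\<sigma> \<tau> \<bullet> v\<bar>) - (\<mu> / 2)\<^sup>2 * T"
      using T by simp
    finally have "\<mu> * integral {t..t + T} (\<lambda>\<tau>. \<bar>\<sigma> \<tau> \<bullet> v\<bar>) - (\<mu> / 2)\<^sup>2 * T
        \<le> integral {t..t + T} (\<lambda>\<tau>. (\<sigma> \<tau> \<bullet> v)\<^sup>2)" .
    moreover have "\<mu> * (\<mu> / 2 * T) \<le> \<mu> * integral {t..t + T} (\<lambda>\<tau>. \<bar>\<sigma> \<tau> \<bullet> v\<bar>)"
      using \<mu> abs_int[OF v] by (intro mult_left_mono) auto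
    moreover have "\<mu> * (\<mu> / 2 * T) = 2 * ((\<mu> / 2)\<^sup>2 * T)"
      by (simp add: power2_eq_square)
    ultimately show ?thesis by linarith
  qed
  have psd: "pos_semidef (integral {t..t + T} (\<lambda>\<tau>. outer (\<sigma> \<tau>)) - ((\<mu> / 2)\<^sup>2 * T) *\<^sub>R mat 1)" for t
  proof -
    define A where "A = integral {t..t + T} (\<lambda>\<tau>. outer (\<sigma> \<tau>))"
    define k where "k = (\<mu> / 2)\<^sup>2 * T"
    have cont': "continuous_on {t..t + T} \<sigma>"
      using cont continuous_on_subset by blast
    have A: "v \<bullet> (A *v v) = integral {t..t + T} (\<lambda>\<tau>. (\<sigma> \<tau> \<bullet> v)\<^sup>2)" "transpose A = A" for v
      unfolding A_def by (rule integral_outer_quadratic_form[OF cont'])+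
    have "transpose (A - k *\<^sub>R mat 1) = transpose A - k *\<^sub>R mat 1"
      by (simp add: transpose_def mat_def vec_eq_iff)
    moreover have "0 \<le> v \<bullet> ((A - k *\<^sub>R mat 1) *v v)" for v
    proof (cases "v = 0")
      case False
      \<comment> \<open>The quadratic form is homogeneous of degree two, so the bound for unit
        vectors scales to all \<open>v\<close>.\<close>
      define u where "u = v /\<^sub>R norm v"
      have u: "norm u = 1" "v = norm v *\<^sub>R u" using False by (auto simp: u_def)
      have "k \<le> u \<bullet> (A *v u)" unfolding A(1) k_def by (rule sq_int[OF u(1)])
      then have "(norm v)\<^sup>2 * k \<le> (norm v)\<^sup>2 * (u \<bullet> (A *v u))" by (intro mult_left_mono) auto
      also have "\<dots> = v \<bullet> (A *v v)"
        using False by (simp add: u_def matrix_vector_mult_scaleR power2_eq_square field_simps)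
      finally have "k * (v \<bullet> v) \<le> v \<bullet> (A *v v)"
        by (simp add: power2_norm_eq_inner mult.commute)
      then show ?thesis
        by (simp add: matrix_vector_mult_diff_rdistrib inner_diff_right
            scaleR_matrix_vector_assoc[symmetric])
    qed simp
    ultimately show ?thesis
      using A(2) by (simp add: pos_semidef_def A_def k_def)
  qed
  have "\<mu> / 2 \<le> 1 / T * integral {t..t + T} (\<lambda>\<tau>. \<bar>\<sigma> \<tau> \<bullet> v\<bar>)" if "norm v = 1" for t v
    using abs_int[OF that, of t] T by (simp add: field_simps)
  moreover have "0 < (\<mu> / 2)\<^sup>2 * T" "0 < \<mu> / 2" using \<mu> T by auto
  ultimately show ?thesis using psd T by blast
qed

section \<open>The derivative of the monomials along the desired trajectory\<close>

theorem theorem1: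
  fixes fb :: "'h::finite \<Rightarrow> real" and f :: "'n::finite \<Rightarrow> 'h \<Rightarrow> nat"
    and g gb :: "'m::finite \<Rightarrow> 'n \<Rightarrow> real"
    and L K :: "'h \<Rightarrow> nat" and a c :: "nat \<Rightarrow> 'h \<Rightarrow> real" and e :: "'h \<Rightarrow> real"
    and b d :: "'m \<Rightarrow> nat \<Rightarrow> 'h \<Rightarrow> real"
  assumes "\<And>h. fb h \<noteq> 0"
    and "\<And>h. \<exists>j. f j h \<noteq> 0"
    and "\<And>i. \<exists>j. g j i \<noteq> 0 \<or> gb j i \<noteq> 0"
    and "trig_representation L K a c e b d (\<lambda>\<omega> t. monomials fb f (desired_state g gb \<omega> t))"
    and "Omega L K b d \<noteq> {}"
  shows "\<forall>\<omega>\<in>Omega L K b d. persistently_excited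
           (\<lambda>t. vector_derivative (\<lambda>\<tau>. monomials fb f (desired_state g gb \<omega> \<tau>)) (at t))"
proof
  fix \<omega> assume \<omega>: "\<omega> \<in> Omega L K b d"
  define w where "w h l = lin_freq b \<omega> l h" for h l
  define z where "z h k = lin_freq d \<omega> k h" for h k
  \<comment> \<open>Coefficients after differentiation, which exchanges the types: sine terms of the
    representation become cosine terms of \<sigma> with factor \<open>A\<close>, cosine terms become
    sine terms with factor \<open>- B\<close>, and the constant \<open>e h\<close> drops
    out.\<close>
  define A where "A h l = a l h * w h l" for h l
  define B where "B h k = c k h * z h k" for h k
  define \<sigma> where "\<sigma> t = (\<chi> h. (\<Sum>l = 1..L h. A h l * cos (w h l * t))
      - (\<Sum>k = 1..K h. B h k * sin (z h k * t)))" for t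
  have "((\<lambda>\<tau>. monomials fb f (desired_state g gb \<omega> \<tau>)) has_vector_derivative \<sigma> t) (at t)" for t
  proof (rule has_vector_derivative_vec_componentwise)
    fix h
    have "((\<lambda>\<tau>. (\<Sum>l = 1..L h. a l h * sin (w h l * \<tau>)) + (\<Sum>k = 1..K h. c k h * cos (z h k * \<tau>)) + e h)
        has_real_derivative (\<Sum>l = 1..L h. a l h * (cos (w h l * t) * w h l))
          + (\<Sum>k = 1..K h. c k h * (- sin (z h k * t) * z h k)) + 0) (at t)"
      by (auto intro!: derivative_eq_intros simp: mult_ac)
    moreover have "monomials fb f (desired_state g gb \<omega> \<tau>) $ h
        = (\<Sum>l = 1..L h. a l h * sin (w h l * \<tau>)) + (\<Sum>k = 1..K h. c k h * cos (z h k * \<tau>)) + e h" for \<tau>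
      using assms(4) by (simp add: trig_representation_def w_def z_def)
    moreover have "(\<Sum>l = 1..L h. a l h * (cos (w h l * t) * w h l))
        + (\<Sum>k = 1..K h. c k h * (- sin (z h k * t) * z h k)) + 0 = \<sigma> t $ h"
      by (simp add: \<sigma>_def A_def B_def sum_negf mult.assoc
          mult.commute[of "w h l" for l] mult.commute[of "z h k" for k])
    ultimately show "((\<lambda>\<tau>. monomials fb f (desired_state g gb \<omega> \<tau>) $ h) has_real_derivative \<sigma> t $ h) (at t)"
      by simp
  qed
  then have \<sigma>_eq: "(\<lambda>t. vector_derivative (\<lambda>\<tau>. monomials fb f (desired_state g gb \<omega> \<tau>)) (at t)) = \<sigma>"
    by (auto simp: vector_derivative_at)
  \<comment> \<open>The derivative of \<sigma> is continuous everywhere, so \<sigma> is continuously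
    differentiable without breakpoints.\<close>
  define \<sigma>' where "\<sigma>' t = (\<chi> h. (\<Sum>l = 1..L h. - sin (w h l * t) * w h l * A h l)
      - (\<Sum>k = 1..K h. cos (z h k * t) * z h k * B h k))" for t
  have deriv: "(\<sigma> has_vector_derivative \<sigma>' t) (at t)" for t
    by (rule has_vector_derivative_vec_componentwise)
      (auto simp: \<sigma>_def \<sigma>'_def intro!: derivative_eq_intros)
  have cont: "continuous_on S \<sigma>" "continuous_on S \<sigma>'" for S
    unfolding \<sigma>_def \<sigma>'_def by (intro continuous_on_vec_lambda continuous_intros)+
  have pw: "\<sigma> piecewise_C1_differentiable_on {0..r}" for r
    using deriv cont(2)
    by (intro C1_differentiable_imp_piecewise) (auto simp: C1_differentiable_on_def)
  have bdd: "bounded (\<sigma> ` {0..})"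
  proof -
    have "norm (\<sigma> t) \<le> (\<Sum>h\<in>UNIV. (\<Sum>l = 1..L h. \<bar>A h l\<bar>) + (\<Sum>k = 1..K h. \<bar>B h k\<bar>))" for t
    proof -
      have "\<bar>\<sigma> t $ h\<bar> \<le> (\<Sum>l = 1..L h. \<bar>A h l\<bar>) + (\<Sum>k = 1..K h. \<bar>B h k\<bar>)" for h
      proof -
        have "\<bar>\<Sum>l = 1..L h. A h l * cos (w h l * t)\<bar> \<le> (\<Sum>l = 1..L h. \<bar>A h l\<bar>)"
          by (rule order_trans[OF sum_abs sum_mono]) (simp add: abs_mult mult_left_le)
        moreover have "\<bar>\<Sum>k = 1..K h. B h k * sin (z h k * t)\<bar> \<le> (\<Sum>k = 1..K h. \<bar>B h k\<bar>)"
          by (rule order_trans[OF sum_abs sum_mono]) (simp add: abs_mult mult_left_le)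
        ultimately show ?thesis by (simp add: \<sigma>_def)
      qed
      then show ?thesis
        by (intro order_trans[OF norm_le_l1_cart sum_mono])
    qed
    then show ?thesis unfolding bounded_iff by blast
  qed

  \<comment> \<open>One selection provides the test frequencies for all components at once.\<close>
  from \<omega> obtain s where sel: "s \<in> selections L K"
    and nonzero: "\<forall>h. P_entry b d \<omega> s h \<noteq> 0"
    and same: "\<forall>h1 h2. h1 \<noteq> h2 \<and> T_entry s h1 = T_entry s h2 \<longrightarrow>
        P_entry b d \<omega> s h1 \<noteq> P_entry b d \<omega> s h2 \<and> P_entry b d \<omega> s h1 \<noteq> - P_entry b d \<omega> s h2"
    and sine: "\<forall>h1 h2. h1 \<noteq> h2 \<and> T_entry s h1 = 0 \<longrightarrow>
        (\<forall>l\<in>{1..L h2}. s h2 \<noteq> Sine l \<longrightarrow>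
          P_entry b d \<omega> s h1 \<noteq> lin_freq b \<omega> l h2 \<and> P_entry b d \<omega> s h1 \<noteq> - lin_freq b \<omega> l h2)"
    and cosine: "\<forall>h1 h2. h1 \<noteq> h2 \<and> T_entry s h1 = 1 \<longrightarrow>
        (\<forall>k\<in>{1..K h2}. s h2 \<noteq> Cosine k \<longrightarrow>
          P_entry b d \<omega> s h1 \<noteq> lin_freq d \<omega> k h2 \<and> P_entry b d \<omega> s h1 \<noteq> - lin_freq d \<omega> k h2)"
    unfolding Omega_def Omega2_def
    by (elim IntE CollectE bexE conjE) (rule that)
  have s: "s h \<in> labels L K h" for h
    using sel by (simp add: selections_def)
  have P0: "P_entry b d \<omega> s h \<noteq> 0" for h
    using nonzero by blast
  have P_same: "P_entry b d \<omega> s h1 \<noteq> P_entry b d \<omega> s h2 \<and> P_entry b d \<omega> s h1 \<noteq> - P_entry b d \<omega> s h2"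
    if "h1 \<noteq> h2" "T_entry s h1 = T_entry s h2" for h1 h2
    using same that by blast
  have P_sin: "P_entry b d \<omega> s h1 \<noteq> w h2 l \<and> P_entry b d \<omega> s h1 \<noteq> - w h2 l"
    if "h1 \<noteq> h2" "T_entry s h1 = 0" "l \<in> {1..L h2}" "s h2 \<noteq> Sine l" for h1 h2 l
    using sine that unfolding w_def by blast
  have P_cos: "P_entry b d \<omega> s h1 \<noteq> z h2 k \<and> P_entry b d \<omega> s h1 \<noteq> - z h2 k"
    if "h1 \<noteq> h2" "T_entry s h1 = 1" "k \<in> {1..K h2}" "s h2 \<noteq> Cosine k" for h1 h2 k
    using cosine that unfolding z_def by blast
  have w_distinct: "w h l \<noteq> w h i \<and> w h l \<noteq> - w h i"
    if "l \<in> {1..L h}" "i \<in> {1..L h}" "i \<noteq> l" for h l i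
  proof -
    \<comment> \<open>\<open>Omega1\<close> speaks of increasing index pairs only; both inequalities
      are symmetric, which gives all pairs of distinct indices.\<close>
    have lt: "w h l \<noteq> w h i \<and> w h l \<noteq> - w h i" if "1 \<le> l" "l < i" "i \<le> L h" for l i
      using \<omega> that unfolding Omega_def Omega1_def w_def by blast
    show ?thesis
      using that lt[of l i] lt[of i l] by (cases "l < i") auto
  qed
  have z_distinct: "z h k \<noteq> z h i \<and> z h k \<noteq> - z h i"
    if "k \<in> {1..K h}" "i \<in> {1..K h}" "i \<noteq> k" for h k i
  proof -
    have lt: "z h k \<noteq> z h i \<and> z h k \<noteq> - z h i" if "1 \<le> k" "k < i" "i \<le> K h" for k i
      using \<omega> that unfolding Omega_def Omega1_def z_def by blast
    show ?thesis
      using that lt[of k i] lt[of i k] by (cases "k < i") auto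
  qed
  have corr: "\<exists>q \<kappa>. continuous_on UNIV q \<and> (\<forall>t. \<bar>q t\<bar> \<le> 1) \<and> \<kappa> \<noteq> 0 \<and>
      (\<forall>h. bounded_primitive (\<lambda>t. \<sigma> t $ h * q t - (if h = h0 then \<kappa> else 0)))" for h0
  proof (cases "s h0")
    \<comment> \<open>The selected sine term appears in \<sigma> as a cosine, so the test function
      is the cosine of the same frequency, and \<kappa> is its mean \<open>A h0 l / 2\<close>. It is
      nonzero because neither the coefficient \<open>a l h0\<close> nor the selected frequency is
      zero.\<close>
    case (Sine l)
    then have l: "l \<in> {1..L h0}" using s[of h0] by (auto simp: labels_def)
    have P: "P_entry b d \<omega> s h0 = w h0 l" and T0: "T_entry s h0 = 0"
      using Sine by (auto simp: P_entry_def T_entry_def w_def)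
    have "w h0 l \<noteq> 0" using P0[of h0] P by simp
    moreover have "a l h0 \<noteq> 0" using assms(4) l by (auto simp: trig_representation_def)
    ultimately have "A h0 l / 2 \<noteq> 0" by (simp add: A_def)
    moreover have "bounded_primitive (\<lambda>t. \<sigma> t $ h * cos (w h0 l * t) - (if h = h0 then A h0 l / 2 else 0))" for h
    proof (cases "h = h0")
      case True
      \<comment> \<open>Within the component \<open>h0\<close> the separation of frequencies comes
        from \<open>Omega1\<close>.\<close>
      then show ?thesis
        using bounded_primitive_trig_cos_selected[of "{1..L h0}" "{1..K h0}" l "w h0" "A h0" "B h0" "z h0"]
          l \<open>w h0 l \<noteq> 0\<close> w_distinct by (simp add: \<sigma>_def)
    next
      case False
      have "w h0 l \<noteq> w h i \<and> w h0 l \<noteq> - w h i" if i: "i \<in> {1..L h}" for i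
      \<comment> \<open>If the entry \<open>i\<close> is itself selected in \<open>h\<close>, two
        selected sine frequencies are compared, which is the second clause of \<open>Omega2\<close>;
        otherwise the third clause applies.\<close>
      proof (cases "s h = Sine i")
        case True
        then have "P_entry b d \<omega> s h = w h i" "T_entry s h = 0"
          by (auto simp: P_entry_def T_entry_def w_def)
        then show ?thesis using P_same[of h0 h] False P T0 by auto
      next
        case nsel: False
        show ?thesis using P_sin[of h0 h i] False T0 i nsel P by auto
      qed
      then show ?thesis
        using False bounded_primitive_trig_cos[of "{1..L h}" "{1..K h}" "w h0 l" "w h" "A h" "B h" "z h"]
        by (simp add: \<sigma>_def)
    qed
    moreover have "continuous_on UNIV (\<lambda>t. cos (w h0 l * t))" by (intro continuous_intros)
    ultimately show ?thesis
      by (intro exI[of _ "\<lambda>t. cos (w h0 l * t)"] exI[of _ "A h0 l / 2"]) auto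
  next
    \<comment> \<open>The dual case: the test function is a sine, and the sign in
      \<open>- B h0 k / 2\<close> stems from differentiating the cosine.\<close>
    case (Cosine k)
    then have k: "k \<in> {1..K h0}" using s[of h0] by (auto simp: labels_def)
    have P: "P_entry b d \<omega> s h0 = z h0 k" and T1: "T_entry s h0 = 1"
      using Cosine by (auto simp: P_entry_def T_entry_def z_def)
    have "z h0 k \<noteq> 0" using P0[of h0] P by simp
    moreover have "c k h0 \<noteq> 0" using assms(4) k by (auto simp: trig_representation_def)
    ultimately have "- B h0 k / 2 \<noteq> 0" by (simp add: B_def)
    moreover have "bounded_primitive (\<lambda>t. \<sigma> t $ h * sin (z h0 k * t) - (if h = h0 then - B h0 k / 2 else 0))" for h
    proof (cases "h = h0")
      case True
      then show ?thesis
        using bounded_primitive_trig_sin_selected[of "{1..L h0}" "{1..K h0}" k "z h0" "A h0" "w h0" "B h0"]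
          k \<open>z h0 k \<noteq> 0\<close> z_distinct by (simp add: \<sigma>_def)
    next
      case False
      have "z h0 k \<noteq> z h i \<and> z h0 k \<noteq> - z h i" if i: "i \<in> {1..K h}" for i
      proof (cases "s h = Cosine i")
        case True
        then have "P_entry b d \<omega> s h = z h i" "T_entry s h = 1"
          by (auto simp: P_entry_def T_entry_def z_def)
        then show ?thesis using P_same[of h0 h] False P T1 by auto
      next
        case nsel: False
        show ?thesis using P_cos[of h0 h i] False T1 i nsel P by auto
      qed
      then show ?thesis
        using False bounded_primitive_trig_sin[of "{1..L h}" "{1..K h}" "z h0 k" "z h" "A h" "w h" "B h"]
        by (simp add: \<sigma>_def)
    qed
    moreover have "continuous_on UNIV (\<lambda>t. sin (z h0 k * t))" by (intro continuous_intros)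
    ultimately show ?thesis
      by (intro exI[of _ "\<lambda>t. sin (z h0 k * t)"] exI[of _ "- B h0 k / 2"]) auto
  qed
  show "persistently_excited
      (\<lambda>t. vector_derivative (\<lambda>\<tau>. monomials fb f (desired_state g gb \<omega> \<tau>)) (at t))"
    unfolding \<sigma>_eq persistently_excited_def
    using pw bdd persistent_excitation_by_correlation[OF cont(1) corr] by blast
qed

end
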